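(* Let $k\ge 2$, $N=d-k+1\ge 1$, and $(s_1,\dots,s_k)\in T_N^k$. For $j=1,\dots,k-1$, $$E_{(s_1,\dots,s_k)}=\sum_{\mathbf u}E_{(u_{j+1}+s_{j+1},\,s_{j+2},\dots,s_k,\,u_1,u_2,\dots,u_j)},$$ where the sum is over all weak compositions $\mathbf u=(u_1,\dots,u_{j+1})\in\mathbb Z_{\ge0}^{j+1}$ of $N-j-\sum_{i=j+1}^k s_i$ (i.e. $u_1+\cdots+u_{j+1}=N-j-\sum_{i=j+1}^k s_i$) that satisfy $$u_1+\cdots+u_h\le s_1+\cdots+s_h-h\qquad\text{for }h=1,\dots,j.$$ When $N=0$, $E_{(0,\dots,0)}=1$.
   Context: For $k\ge1$ and $N\ge0$, $T_N^k=\{(s_1,\dots,s_k)\in\mathbb Z_{\ge0}^k: s_1+\cdots+s_k=N\}$. For $k,m\ge1$, the distance graph $G(k,m)$ is the directed graph on vertex set $\{1,\dots,m\}$ with slack edges $(i,i+1)$ for $1\le i\le m-1$ and non-slack edges $(i,i+k)$ for $1\le i\le m-k$ (none if $m\le k$). An integral $\mathbf a$-flow on a directed graph on $\{1,\dots,m\}$ is an assignment of nonnegative integers $f_e$ to the edges such that at every vertex $i$ the total outgoing flow minus the total incoming flow equals $a_i$. $k$-Entringer numbers: let $k\ge2$, $N=d-k+1\ge0$ and $\mathbf s=(s_1,\dots,s_k)\in T_N^k$. $E_{\mathbf s}$ is the number of integral flows on $G(k,d)$ with net flow $(1^{d-1},-d+1)$ (entries $1$ at vertices $1,\dots,d-1$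 and $-(d-1)$ at vertex $d$) whose flow on the slack edge $(d-k+1,d-k+2)$ is $s_1$ and whose flows on the last $k-1$ non-slack edges, read from right to left, are $s_2,\dots,s_k$; that is, the flow on $(N-i,N-i+k)$ is $s_{i+1}$ for $i=1,\dots,k-1$. If such an edge does not exist because its tail would be $\le 0$ (small $N$), the flow on it is taken to be $0$. Here $d$ is determined by $\mathbf s$ via $d=N+k-1$, $N=s_1+\cdots+s_k$.
   Formalization: The identity is stated for j ≤ min(k−1, N) only; for j > N the right-hand sum is empty and the claim can fail, e.g. k=3, N=1, s=(1,0,0), j=2, where E_s=1. *)

theory Defs
  imports Main "Graph_Theory.Digraph"
begin

text \<open>Tuples \<open>(s\<^sub>1, \<dots>, s\<^sub>k)\<close> are lists, so \<open>s\<^sub>i\<close> is \<open>s ! (i - 1)\<close>.\<close>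

definition weak_compositions :: "nat \<Rightarrow> int \<Rightarrow> nat list set" where
  "weak_compositions k n = {s. length s = k \<and> int (sum_list s) = n}"

text \<open>Arcs carry their kind and their tail. In particular, for \<open>k = 1\<close> the slack edge and the
  non-slack edge from \<open>i\<close> to \<open>i + 1\<close> are distinct parallel arcs.\<close>

datatype dist_arc = Slack nat | Nonslack nat

definition distance_graph :: "nat \<Rightarrow> nat \<Rightarrow> (nat, dist_arc) pre_digraph" where
  "distance_graph k m =
    \<lparr> verts = {1..m},
      arcs = Slack ` {i. 1 \<le> i \<and> i + 1 \<le> m} \<union> Nonslack ` {i. 1 \<le> i \<and> i + k \<le> m},
      tail = (\<lambda>e. case e of Slack i \<Rightarrow> i | Nonslack i \<Rightarrow> i),
      head = (\<lambda>e. case e of Slack i \<Rightarrow> i + 1 | Nonslack i \<Rightarrow> i + k) \<rparr>"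

text \<open>Flows are required to vanish outside the arcs of the graph, so that distinct functions
  are distinct flows and the flow on a non-existent edge is \<open>0\<close>.\<close>

definition integral_flows :: "('v, 'e) pre_digraph \<Rightarrow> ('v \<Rightarrow> int) \<Rightarrow> ('e \<Rightarrow> nat) set" where
  "integral_flows G a =
    {f. (\<forall>e. e \<notin> arcs G \<longrightarrow> f e = 0) \<and>
        (\<forall>v \<in> verts G. (\<Sum>e\<in>out_arcs G v. int (f e)) - (\<Sum>e\<in>in_arcs G v. int (f e)) = a v)}"

definition entringer_net_flow :: "nat \<Rightarrow> nat \<Rightarrow> int" where
  "entringer_net_flow d v = (if v = d then - (int d - 1) else 1)"

text \<open>Meant for \<open>length s \<ge> 2\<close>. Since \<open>N = d - k + 1\<close>, the distinguished slack edge
  \<open>(d - k + 1, d - k + 2)\<close> is \<open>Slack N\<close>. Whenever \<open>N - i\<close> would be \<open>\<le> 0\<close>, the truncated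
  difference is \<open>0\<close>, which is not a vertex, so the flow there is \<open>0\<close>. The set counted is finite:
  the graph is acyclic, hence every flow on it is bounded by the net flow.\<close>

definition entringer :: "nat list \<Rightarrow> nat" where
  "entringer s =
    (let k = length s; N = sum_list s; d = N + k - 1
     in card {f \<in> integral_flows (distance_graph k d) (entringer_net_flow d).
               f (Slack N) = s ! 0 \<and> (\<forall>i\<in>{1..k-1}. f (Nonslack (N - i)) = s ! i)})"

end

theory Submission
  imports Defs
begin

text \<open>In the flows counted by \<open>entringer s\<close>, the prescribed flows are those on all edges leaving
  \<open>{1..N}\<close>, and they determine the flow to the right of \<open>N\<close>. Vertex \<open>N\<close> sends everything along its
  slack edge, so \<open>s\<^sub>1 - 1\<close> splits into the flow \<open>a\<close> on \<open>(N - k, N)\<close> and the flow on \<open>(N - 1, N)\<close>.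
  Merging the latter with the flow \<open>s\<^sub>2\<close> on the non-slack edge at \<open>N - 1\<close> gives a flow counted by the
  tuple \<open>(s\<^sub>1 - 1 - a + s\<^sub>2, s\<^sub>3, \<dots>, s\<^sub>k, a)\<close>. This is the case \<open>j = 1\<close>; the general case is its
  \<open>j\<close>-fold iteration.\<close>

section \<open>Vertex balances on the distance graph\<close>

lemma integral_flows_distance_graph:
  assumes "k \<ge> 1"
  shows "f \<in> integral_flows (distance_graph k m) a \<longleftrightarrow>
    (\<forall>i. \<not> (1 \<le> i \<and> i + 1 \<le> m) \<longrightarrow> f (Slack i) = 0) \<and>
    (\<forall>i. \<not> (1 \<le> i \<and> i + k \<le> m) \<longrightarrow> f (Nonslack i) = 0) \<and>
    (\<forall>v\<in>{1..m}. int (f (Slack v)) + int (f (Nonslack v))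
       - (int (f (Slack (v - 1))) + int (f (Nonslack (v - k)))) = a v)"
proof -
  let ?G = "distance_graph k m"
  have support: "(\<forall>e. e \<notin> arcs ?G \<longrightarrow> f e = 0) \<longleftrightarrow>
      (\<forall>i. \<not> (1 \<le> i \<and> i + 1 \<le> m) \<longrightarrow> f (Slack i) = 0) \<and>
      (\<forall>i. \<not> (1 \<le> i \<and> i + k \<le> m) \<longrightarrow> f (Nonslack i) = 0)"
    (is "?L \<longleftrightarrow> ?R")
  proof
    assume ?L
    then show ?R by (auto simp: distance_graph_def)
  next
    assume R: ?R
    show ?L
    proof (intro allI impI)
      fix e assume "e \<notin> arcs ?G"
      then show "f e = 0"
        using R by (cases e) (auto simp: distance_graph_def)
    qed
  qed
  have out_sum: "(\<Sum>e\<in>out_arcs ?G v. int (f e)) = int (f (Slack v)) + int (f (Nonslack v))"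
    if ?L "v \<in> {1..m}" for v
  proof -
    have "(\<Sum>e\<in>out_arcs ?G v. int (f e)) = (\<Sum>e\<in>{Slack v, Nonslack v}. int (f e))"
      using that by (intro sum.mono_neutral_left)
        (auto simp: distance_graph_def out_arcs_def image_iff)
    then show ?thesis by simp
  qed
  \<comment> \<open>If \<open>v - 1\<close> or \<open>v - k\<close> is truncated to
    \<open>0\<close>, the corresponding arc is not in the graph, so by the support condition it
    contributes nothing.\<close>
  have in_sum: "(\<Sum>e\<in>in_arcs ?G v. int (f e)) =
      int (f (Slack (v - 1))) + int (f (Nonslack (v - k)))"
    if ?L "v \<in> {1..m}" for v
  proof -
    have "(\<Sum>e\<in>in_arcs ?G v. int (f e)) = (\<Sum>e\<in>{Slack (v - 1), Nonslack (v - k)}. int (f e))"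
      using that assms by (intro sum.mono_neutral_left)
        (auto simp: distance_graph_def in_arcs_def image_iff)
    then show ?thesis by simp
  qed
  have "f \<in> integral_flows ?G a \<longleftrightarrow> ?L \<and>
      (\<forall>v\<in>{1..m}. (\<Sum>e\<in>out_arcs ?G v. int (f e)) - (\<Sum>e\<in>in_arcs ?G v. int (f e)) = a v)"
    by (simp add: integral_flows_def) (simp add: distance_graph_def)
  also have "\<dots> \<longleftrightarrow> ?L \<and> (\<forall>v\<in>{1..m}. int (f (Slack v)) + int (f (Nonslack v))
       - (int (f (Slack (v - 1))) + int (f (Nonslack (v - k)))) = a v)"
    using out_sum in_sum by auto
  finally show ?thesis unfolding support by simp
qed

section \<open>Cutting an Entringer flow at vertex \<open>N\<close>\<close>

text \<open>The part of an Entringer flow strictly to the left of the cut. Here and below, truncated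
  subtraction refers missing edges to tail \<open>0\<close>, where the flow is \<open>0\<close>.\<close>

definition left_flows :: "nat \<Rightarrow> nat \<Rightarrow> nat list \<Rightarrow> (dist_arc \<Rightarrow> nat) set" where
  "left_flows k N s = {f.
     (\<forall>i. \<not> (1 \<le> i \<and> i < N) \<longrightarrow> f (Slack i) = 0 \<and> f (Nonslack i) = 0) \<and>
     (\<forall>v\<in>{1..<N}. f (Slack v) + f (Nonslack v) = 1 + f (Slack (v - 1)) + f (Nonslack (v - k))) \<and>
     s ! 0 = (if N = 0 then 0 else 1 + f (Slack (N - 1)) + f (Nonslack (N - k))) \<and>
     (\<forall>i\<in>{1..k-1}. f (Nonslack (N - i)) = s ! i)}"

definition truncate_flow :: "nat \<Rightarrow> (dist_arc \<Rightarrow> nat) \<Rightarrow> dist_arc \<Rightarrow> nat" where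
  "truncate_flow N f e =
     (case e of Slack i \<Rightarrow> if i < N then f e else 0 | Nonslack i \<Rightarrow> if i < N then f e else 0)"

text \<open>This is the flow forced on \<open>Slack (N + t)\<close>. No non-slack edge leaves a
  vertex from \<open>N\<close> on, so each vertex \<open>N + r\<close> passes on its own unit
  together with the inflow \<open>s ! (k - r)\<close> from the cut edge with tail
  \<open>N - (k - r)\<close>, where \<open>k = length s\<close>.\<close>

definition right_slack :: "nat list \<Rightarrow> nat \<Rightarrow> nat" where
  "right_slack s t = s ! 0 + t + (\<Sum>r = 1..t. s ! (length s - r))"

definition extend_flow :: "nat \<Rightarrow> nat list \<Rightarrow> (dist_arc \<Rightarrow> nat) \<Rightarrow> dist_arc \<Rightarrow> nat" where
  "extend_flow N s f e =
     (case e of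
        Slack i \<Rightarrow> if N \<le> i \<and> i + 1 < N + length s then right_slack s (i - N) else f e
      | Nonslack i \<Rightarrow> f e)"

lemma truncate_flow_simps [simp]:
  "truncate_flow N f (Slack i) = (if i < N then f (Slack i) else 0)"
  "truncate_flow N f (Nonslack i) = (if i < N then f (Nonslack i) else 0)"
  by (simp_all add: truncate_flow_def)

lemma extend_flow_simps [simp]:
  "extend_flow N s f (Slack i) =
     (if N \<le> i \<and> i + 1 < N + length s then right_slack s (i - N) else f (Slack i))"
  "extend_flow N s f (Nonslack i) = f (Nonslack i)"
  by (simp_all add: extend_flow_def)

lemma right_slack_0 [simp]: "right_slack s 0 = s ! 0"
  by (simp add: right_slack_def)

lemma right_slack_Suc: "right_slack s (Suc t) = 1 + right_slack s t + s ! (length s - Suc t)"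
  by (simp add: right_slack_def)

text \<open>The value at \<open>k - 1\<close> is what vertex \<open>d = N + k - 1\<close> would pass
  on if its net flow were also \<open>1\<close>. As the entries of \<open>s\<close> sum to
  \<open>N\<close>, it equals \<open>d\<close>; this makes the balance at the sink
  automatic.\<close>

lemma right_slack_last:
  assumes "length s \<ge> 1"
  shows "right_slack s (length s - 1) = sum_list s + length s - 1"
proof -
  have "(\<Sum>r = 1..length s - 1. s ! (length s - r)) = (\<Sum>i = 1..length s - 1. s ! i)"
    by (rule sum.reindex_bij_witness[where i = "\<lambda>i. length s - i" and j = "\<lambda>i. length s - i"])
      auto
  moreover have "sum_list s = s ! 0 + (\<Sum>i = 1..length s - 1. s ! i)"
  proof -
    have "{0..<length s} = insert 0 {1..length s - 1}" using assms by auto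
    then show ?thesis by (simp add: sum_list_sum_nth)
  qed
  ultimately show ?thesis using assms by (simp add: right_slack_def)
qed

definition entringer_flows :: "nat list \<Rightarrow> (dist_arc \<Rightarrow> nat) set" where
  "entringer_flows s =
     {f \<in> integral_flows (distance_graph (length s) (sum_list s + length s - 1))
            (entringer_net_flow (sum_list s + length s - 1)).
        f (Slack (sum_list s)) = s ! 0 \<and>
        (\<forall>i\<in>{1..length s - 1}. f (Nonslack (sum_list s - i)) = s ! i)}"

lemma entringer_eq_card: "entringer s = card (entringer_flows s)"
  by (simp add: entringer_def entringer_flows_def Let_def)

text \<open>With \<open>d = N + k - 1\<close>, the bound \<open>v + 2 \<le> N + k\<close> means
  \<open>v < d\<close>, and a non-slack edge \<open>(i, i + k)\<close> fits into the graph iff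
  \<open>i < N\<close>. The sink \<open>d\<close> is treated separately: nothing leaves it, and its
  incoming edges have tails \<open>d - 1 = N + k - 2\<close> and
  \<open>d - k = N - 1\<close>.\<close>

lemma entringer_flows_iff:
  fixes N k :: nat
  assumes k: "length s = k" "k \<ge> 2" and N: "sum_list s = N"
  shows "f \<in> entringer_flows s \<longleftrightarrow>
    (\<forall>i. \<not> (1 \<le> i \<and> i + 2 \<le> N + k) \<longrightarrow> f (Slack i) = 0) \<and>
    (\<forall>i. \<not> (1 \<le> i \<and> i < N) \<longrightarrow> f (Nonslack i) = 0) \<and>
    (\<forall>v. 1 \<le> v \<and> v + 2 \<le> N + k \<longrightarrow>
      f (Slack v) + f (Nonslack v) = 1 + f (Slack (v - 1)) + f (Nonslack (v - k))) \<and>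
    f (Slack (N + k - 2)) + f (Nonslack (N - 1)) = N + k - 2 \<and>
    f (Slack N) = s ! 0 \<and> (\<forall>i\<in>{1..k-1}. f (Nonslack (N - i)) = s ! i)"
proof -
  define d where "d = N + k - 1"
  have d: "d + 1 = N + k" "d \<ge> 1" using k by (auto simp: d_def)
  have flow: "(\<forall>v\<in>{1..d}. int (f (Slack v)) + int (f (Nonslack v))
       - (int (f (Slack (v - 1))) + int (f (Nonslack (v - k)))) = entringer_net_flow d v) \<longleftrightarrow>
     (\<forall>v. 1 \<le> v \<and> v < d \<longrightarrow>
       f (Slack v) + f (Nonslack v) = 1 + f (Slack (v - 1)) + f (Nonslack (v - k))) \<and>
     f (Slack (d - 1)) + f (Nonslack (N - 1)) = d - 1"
    if "f (Slack d) = 0" "f (Nonslack d) = 0"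
  proof -
    have "{1..d} = insert d {1..<d}" using d by auto
    moreover have "d - k = N - 1" using d by auto
    moreover have "entringer_net_flow d d = - int (d - 1)"
      using d by (simp add: entringer_net_flow_def)
    moreover have "entringer_net_flow d v = 1" if "v < d" for v
      using that by (simp add: entringer_net_flow_def)
    moreover have "int a + int b - (int c + int e) = 1 \<longleftrightarrow> a + b = 1 + c + e" for a b c e
      by linarith
    moreover have "(- int c - int e = - int (d - 1)) \<longleftrightarrow> c + e = d - 1" for c e
      by linarith
    ultimately show ?thesis using that by auto
  qed
  have "1 \<le> i \<and> i + k \<le> d \<longleftrightarrow> 1 \<le> i \<and> i < N" for i
    using d by linarith
  moreover have "1 \<le> i \<and> i + 1 \<le> d \<longleftrightarrow> 1 \<le> i \<and> i + 2 \<le> N + k" for i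
    using d by linarith
  moreover have "v < d \<longleftrightarrow> v + 2 \<le> N + k" for v
    using d by linarith
  moreover have "N + k - 2 = d - 1" using d by linarith
  moreover have "k \<ge> 1" using k by simp
  moreover have "\<not> d + 2 \<le> N + k" "\<not> d < N" using d k by linarith+
  ultimately show ?thesis
    using flow
    unfolding entringer_flows_def k N d_def[symmetric] mem_Collect_eq
    by (subst integral_flows_distance_graph) auto
qed

text \<open>The condition on \<open>s ! 0\<close> is the balance at vertex \<open>N\<close>, whose
  only outgoing edge is the slack edge because \<open>N + k > d\<close>. For \<open>N = 0\<close>
  that edge is missing and \<open>s ! 0 = 0\<close>.\<close>

lemma truncate_flow_mem_left_flows:
  assumes k: "length s = k" "k \<ge> 2" and N: "sum_list s = N" and f: "f \<in> entringer_flows s"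
  shows "truncate_flow N f \<in> left_flows k N s"
proof -
  note F = f[unfolded entringer_flows_iff[OF k N]]
  have "s ! 0 = (if N = 0 then 0 else 1 + f (Slack (N - 1)) + f (Nonslack (N - k)))"
  proof (cases "N = 0")
    case True
    then show ?thesis using F by auto
  next
    case False
    then have "1 \<le> N \<and> N + 2 \<le> N + k" using k by simp
    then have "f (Slack N) + f (Nonslack N) = 1 + f (Slack (N - 1)) + f (Nonslack (N - k))"
      using F by blast
    moreover have "f (Nonslack N) = 0" "f (Slack N) = s ! 0" using F by auto
    ultimately show ?thesis using False by simp
  qed
  moreover have "f (Nonslack (N - i)) = s ! i" if "i \<in> {1..k-1}" for i
    using F that by blast
  moreover have "f (Nonslack i) = 0" if "\<not> i < N" for i using F that by auto
  ultimately show ?thesis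
    using F k unfolding left_flows_def by auto
qed

lemma extend_flow_mem_entringer_flows:
  assumes k: "length s = k" "k \<ge> 2" and N: "sum_list s = N" and f: "f \<in> left_flows k N s"
  shows "extend_flow N s f \<in> entringer_flows s"
proof -
  note F = f[unfolded left_flows_def mem_Collect_eq]
  let ?g = "extend_flow N s f"
  have support: "f (Slack i) = 0" "f (Nonslack i) = 0" if "\<not> (1 \<le> i \<and> i < N)" for i
    using F that by auto
  have cut: "f (Nonslack (N - i)) = s ! i" if "1 \<le> i" "i < k" for i
    using F that by auto
  have "?g (Slack i) = 0" if "\<not> (1 \<le> i \<and> i + 2 \<le> N + k)" for i
    using that support[of i] F k by auto
  moreover have "?g (Nonslack i) = 0" if "\<not> (1 \<le> i \<and> i < N)" for i
    using that support by simp
  moreover have "?g (Slack v) + ?g (Nonslack v) = 1 + ?g (Slack (v - 1)) + ?g (Nonslack (v - k))"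
    if v: "1 \<le> v" "v + 2 \<le> N + k" for v
  proof -
    consider "v < N" | "v = N" | "v > N" by linarith
    then show ?thesis
    proof cases
      case 1
      then show ?thesis using v F by auto
    next
      case 2
      then show ?thesis using v F support[of N] k by auto
    next
      case 3
      then obtain t where t: "v = N + Suc t" by (metis add_Suc_right less_imp_Suc_add)
      \<comment> \<open>The non-slack edge entering a vertex to the right of \<open>N\<close> is one
        of the cut edges, or missing, with prescribed flow in either case.\<close>
      have "v - k = N - (k - Suc t)" using t v by linarith
      then have "f (Nonslack (v - k)) = s ! (k - Suc t)" using cut[of "k - Suc t"] t v by auto
      then show ?thesis using t v k support[of v] by (auto simp: right_slack_Suc)
    qed
  qed
  \<comment> \<open>Run the recursion for \<open>right_slack\<close> one step further, to the sink:
    the total there is \<open>N + k - 1\<close>, and removing the extra unit leaves the required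
    inflow.\<close>
  moreover have "?g (Slack (N + k - 2)) + ?g (Nonslack (N - 1)) = N + k - 2"
  proof -
    have e: "Suc (k - 2) = k - 1" "k - (k - 1) = 1" "N + k - 2 - N = k - 2" using k by auto
    have "?g (Slack (N + k - 2)) = right_slack s (k - 2)" using k e by auto
    moreover have "right_slack s (k - 1) = 1 + right_slack s (k - 2) + s ! 1"
      using right_slack_Suc[of s "k - 2"] e k by simp
    moreover have "right_slack s (k - 1) = N + k - 1"
      using right_slack_last[of s] k N by simp
    moreover have "?g (Nonslack (N - 1)) = s ! 1" using cut[of 1] k by simp
    ultimately show ?thesis by linarith
  qed
  moreover have "?g (Slack N) = s ! 0" using k by simp
  moreover have "\<forall>i\<in>{1..k-1}. ?g (Nonslack (N - i)) = s ! i" using F by simp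
  ultimately show ?thesis unfolding entringer_flows_iff[OF k N] by blast
qed

text \<open>The balances at \<open>N + 1\<close>, \<open>N + 2\<close>, ... determine the slack
  flows one after another, starting from the prescribed value on \<open>Slack N\<close>.\<close>

lemma extend_truncate_flow:
  assumes k: "length s = k" "k \<ge> 2" and N: "sum_list s = N" and f: "f \<in> entringer_flows s"
  shows "extend_flow N s (truncate_flow N f) = f"
proof
  note F = f[unfolded entringer_flows_iff[OF k N]]
  have slack: "f (Slack (N + t)) = right_slack s t" if "t + 2 \<le> k" for t
    using that
  proof (induction t)
    case 0
    then show ?case using F by simp
  next
    case (Suc t)
    have "N + Suc t - k = N - (k - Suc t)" using Suc.prems by linarith
    moreover have "k - Suc t \<in> {1..k-1}" using Suc.prems by auto
    ultimately have "f (Nonslack (N + Suc t - k)) = s ! (k - Suc t)" using F by metis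
    moreover have "f (Nonslack (N + Suc t)) = 0" using F by auto
    moreover have "f (Slack (N + Suc t)) + f (Nonslack (N + Suc t)) =
        1 + f (Slack (N + Suc t - 1)) + f (Nonslack (N + Suc t - k))"
    proof -
      have "1 \<le> N + Suc t \<and> N + Suc t + 2 \<le> N + k" using Suc.prems by auto
      then show ?thesis using F by blast
    qed
    ultimately show ?case using Suc k by (simp add: right_slack_Suc)
  qed
  fix e
  show "extend_flow N s (truncate_flow N f) e = f e"
  proof (cases e)
    case (Slack i)
    consider "i < N" | t where "i = N + t" "t + 2 \<le> k" | "i + 2 > N + k"
      by (metis add_le_imp_le_left group_cancel.add1 le_Suc_ex not_le)
    then show ?thesis
      using Slack slack F k by cases auto
  next
    case (Nonslack i)
    then show ?thesis using F by auto
  qed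
qed

lemma truncate_extend_flow:
  assumes "f \<in> left_flows k N s"
  shows "truncate_flow N (extend_flow N s f) = f"
proof
  fix e
  show "truncate_flow N (extend_flow N s f) e = f e"
    using assms by (cases e) (auto simp: left_flows_def)
qed

text \<open>In \<open>left_flows\<close> the cut \<open>N\<close> is a free parameter, not tied to
  the sum of the tuple, so induction on \<open>N\<close> becomes possible.\<close>

lemma entringer_eq_card_left_flows:
  assumes "length s = k" "k \<ge> 2" "sum_list s = N"
  shows "entringer s = card (left_flows k N s)"
proof -
  have "bij_betw (truncate_flow N) (entringer_flows s) (left_flows k N s)"
  proof (rule bij_betw_byWitness[where f' = "extend_flow N s"])
    show "\<forall>f\<in>entringer_flows s. extend_flow N s (truncate_flow N f) = f"
      using extend_truncate_flow[OF assms] by blast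
    show "\<forall>f\<in>left_flows k N s. truncate_flow N (extend_flow N s f) = f"
      using truncate_extend_flow by blast
    show "truncate_flow N ` entringer_flows s \<subseteq> left_flows k N s"
      using truncate_flow_mem_left_flows[OF assms] by blast
    show "extend_flow N s ` left_flows k N s \<subseteq> entringer_flows s"
      using extend_flow_mem_entringer_flows[OF assms] by blast
  qed
  then show ?thesis by (simp add: entringer_eq_card bij_betw_same_card)
qed

section \<open>Moving the cut by one vertex\<close>

lemma left_flows_0:
  "left_flows k 0 s = (if s ! 0 = 0 \<and> (\<forall>i\<in>{1..k-1}. s ! i = 0) then {\<lambda>_. 0} else {})"
proof -
  have "f = (\<lambda>_. 0)" if "\<forall>i. f (Slack i) = 0 \<and> f (Nonslack i) = 0" for f :: "dist_arc \<Rightarrow> nat"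
    using that by (metis dist_arc.exhaust)
  then show ?thesis by (auto simp: left_flows_def)
qed

text \<open>The data of the same flow when the cut moves from \<open>N + 1\<close> to
  \<open>N\<close>: the first entry is the total outflow of vertex \<open>N\<close>, and
  \<open>a\<close> is the flow on the edge with tail \<open>N - (k - 1)\<close>, now the last one
  recorded. The subtraction is exact for \<open>a < s ! 0\<close>, the only range summed
  over.\<close>

definition step_tuple :: "nat list \<Rightarrow> nat \<Rightarrow> nat list" where
  "step_tuple s a = (s ! 0 - 1 - a + s ! 1) # drop 2 s @ [a]"

lemma step_tuple_nth:
  assumes "length s \<ge> 2"
  shows "step_tuple s a ! 0 = s ! 0 - 1 - a + s ! 1"
    and "\<lbrakk>1 \<le> i; i + 1 < length s\<rbrakk> \<Longrightarrow> step_tuple s a ! i = s ! (i + 1)"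
    and "step_tuple s a ! (length s - 1) = a"
  using assms by (auto simp: step_tuple_def nth_Cons' nth_append)

text \<open>The edges leaving vertex \<open>N\<close> are the only ones that a left flow gains when
  the cut moves to \<open>N + 1\<close>; their flows split the total
  \<open>step_tuple s a ! 0\<close>.\<close>

definition push_flow :: "nat \<Rightarrow> nat list \<Rightarrow> nat \<Rightarrow> (dist_arc \<Rightarrow> nat) \<Rightarrow> dist_arc \<Rightarrow> nat" where
  "push_flow N s a g = g(Slack N := s ! 0 - 1 - a, Nonslack N := s ! 1)"

lemma push_flow_mem_left_flows:
  assumes k: "length s = k" "k \<ge> 2" and a: "a < s ! 0" and g: "g \<in> left_flows k N (step_tuple s a)"
  shows "push_flow N s a g \<in> left_flows k (Suc N) s"
proof -
  note G = g[unfolded left_flows_def mem_Collect_eq]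
  let ?f = "push_flow N s a g"
  note nth = step_tuple_nth[OF k(2)[folded k(1)], unfolded k(1)]
  have g0: "g (Slack N) = 0" "g (Nonslack N) = 0" using G by auto
  \<comment> \<open>The last cut edge at \<open>N\<close> is the non-slack edge entering
    \<open>N + 1\<close>.\<close>
  have last: "g (Nonslack (Suc N - k)) = a"
  proof -
    have "k - 1 \<in> {1..k-1}" using k by simp
    then have "g (Nonslack (N - (k - 1))) = a" using G nth(3) by metis
    moreover have "N - (k - 1) = Suc N - k" using k by auto
    ultimately show ?thesis by simp
  qed
  \<comment> \<open>For \<open>N = 0\<close> this forces both summands on the left to vanish, so the
    values that \<open>push_flow\<close> writes at the nonexistent tail \<open>0\<close> are
    \<open>0\<close>.\<close>
  have first: "s ! 0 - 1 - a + s ! 1 = (if N = 0 then 0 else 1 + g (Slack (N - 1)) + g (Nonslack (N - k)))"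
    using G nth(1) by auto
  have "?f (Slack i) = 0 \<and> ?f (Nonslack i) = 0" if "\<not> (1 \<le> i \<and> i < Suc N)" for i
    using that G first by (cases "i = N") (auto simp: push_flow_def)
  moreover have "?f (Slack v) + ?f (Nonslack v) = 1 + ?f (Slack (v - 1)) + ?f (Nonslack (v - k))"
    if "v \<in> {1..<Suc N}" for v
  proof (cases "v = N")
    case True
    then have "N - 1 \<noteq> N" "N - k \<noteq> N" using that k by auto
    then show ?thesis using True that first by (simp add: push_flow_def)
  next
    case False
    then have "v \<in> {1..<N}" "v - 1 \<noteq> N" "v - k \<noteq> N" using that by auto
    moreover from this(1) have
      "g (Slack v) + g (Nonslack v) = 1 + g (Slack (v - 1)) + g (Nonslack (v - k))"
      using G by blast
    ultimately show ?thesis using False by (simp add: push_flow_def)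
  qed
  moreover have "s ! 0 = 1 + ?f (Slack N) + ?f (Nonslack (Suc N - k))"
    using a last k first g0 by (cases "N = 0") (auto simp: push_flow_def)
  moreover have "?f (Nonslack (Suc N - i)) = s ! i" if i: "i \<in> {1..k-1}" for i
  proof (cases "i = 1")
    case True
    then show ?thesis by (simp add: push_flow_def)
  next
    case False
    then obtain m where m: "i = Suc m" "1 \<le> m" using i by (cases i) auto
    have "g (Nonslack (N - m)) = s ! i" using G nth(2)[of m] m i by auto
    then show ?thesis using m first g0 by (cases "N = 0") (auto simp: push_flow_def)
  qed
  ultimately show ?thesis by (simp add: left_flows_def)
qed

lemma left_flows_Suc_obtain:
  assumes k: "length s = k" "k \<ge> 2" and f: "f \<in> left_flows k (Suc N) s"
  obtains a g where "a < s ! 0" "g \<in> left_flows k N (step_tuple s a)" "f = push_flow N s a g"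
proof -
  note F = f[unfolded left_flows_def mem_Collect_eq]
  note nth = step_tuple_nth[OF k(2)[folded k(1)], unfolded k(1)]
  define a where "a = f (Nonslack (Suc N - k))"
  have s0: "s ! 0 = 1 + f (Slack N) + a" using F by (simp add: a_def)
  have f_cut: "f (Nonslack (Suc N - i)) = s ! i" if "1 \<le> i" "i < k" for i
    using F that by auto
  have s1: "f (Nonslack N) = s ! 1" using f_cut[of 1] k by simp
  have "truncate_flow N f \<in> left_flows k N (step_tuple s a)"
  proof -
    have "step_tuple s a ! 0 =
        (if N = 0 then 0 else 1 + f (Slack (N - 1)) + f (Nonslack (N - k)))"
    proof (cases "N = 0")
      case True
      then show ?thesis using F s0 s1 by (auto simp: nth(1))
    next
      case False
      then have "f (Slack N) + f (Nonslack N) = 1 + f (Slack (N - 1)) + f (Nonslack (N - k))"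
        using F by auto
      then show ?thesis using False s0 s1 by (simp add: nth(1))
    qed
    moreover have "truncate_flow N f (Nonslack (N - i)) = step_tuple s a ! i" if i: "i \<in> {1..k-1}" for i
    proof -
      have "step_tuple s a ! i = f (Nonslack (N - i))"
      proof (cases "i = k - 1")
        case True
        have "Suc N - k = N - (k - 1)" using k by auto
        then show ?thesis unfolding True nth(3) a_def by (simp only:)
      next
        case False
        then show ?thesis using i f_cut[of "i + 1"] nth(2)[of i] by auto
      qed
      \<comment> \<open>For \<open>N = 0\<close> the index \<open>N - i\<close> is not below
        \<open>N\<close>, so truncation returns \<open>0\<close>; this is also the value of
        \<open>f\<close> there.\<close>
      moreover have "f (Nonslack 0) = 0" using F by auto
      ultimately show ?thesis using i by (cases N) auto
    qed
    ultimately show ?thesis using F k unfolding left_flows_def by auto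
  qed
  moreover have "f = push_flow N s a (truncate_flow N f)"
  proof
    fix e
    show "f e = push_flow N s a (truncate_flow N f) e"
      using s0 s1 F by (cases e) (auto simp: push_flow_def)
  qed
  ultimately show ?thesis using that[of a] s0 by auto
qed

lemma left_flows_Suc:
  assumes "length s = k" "k \<ge> 2"
  shows "left_flows k (Suc N) s =
    (\<Union>a<s ! 0. push_flow N s a ` left_flows k N (step_tuple s a))"
proof (intro set_eqI iffI)
  fix f assume "f \<in> left_flows k (Suc N) s"
  then show "f \<in> (\<Union>a<s ! 0. push_flow N s a ` left_flows k N (step_tuple s a))"
    by (rule left_flows_Suc_obtain[OF assms]) auto
next
  fix f assume "f \<in> (\<Union>a<s ! 0. push_flow N s a ` left_flows k N (step_tuple s a))"
  then show "f \<in> left_flows k (Suc N) s"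
    using push_flow_mem_left_flows[OF assms] by auto
qed

lemma length_step_tuple [simp]: "length s \<ge> 2 \<Longrightarrow> length (step_tuple s a) = length s"
  by (simp add: step_tuple_def)

lemma finite_left_flows:
  assumes "length s = k" "k \<ge> 2"
  shows "finite (left_flows k N s)"
  using assms
proof (induction N arbitrary: s)
  case 0
  then show ?case by (simp add: left_flows_0)
next
  case (Suc N)
  then show ?case by (auto simp: left_flows_Suc)
qed

lemma inj_on_push_flow: "inj_on (push_flow N s a) (left_flows k N t)"
proof (rule inj_on_inverseI[where g = "truncate_flow N"])
  fix g assume g: "g \<in> left_flows k N t"
  show "truncate_flow N (push_flow N s a g) = g"
  proof
    fix e
    show "truncate_flow N (push_flow N s a g) e = g e"
      using g by (cases e) (auto simp: left_flows_def push_flow_def)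
  qed
qed

lemma card_left_flows_Suc:
  assumes "length s = k" "k \<ge> 2"
  shows "card (left_flows k (Suc N) s) = (\<Sum>a<s ! 0. card (left_flows k N (step_tuple s a)))"
proof -
  have "card (left_flows k (Suc N) s) =
      (\<Sum>a<s ! 0. card (push_flow N s a ` left_flows k N (step_tuple s a)))"
    unfolding left_flows_Suc[OF assms]
  proof (rule card_UN_disjoint)
    show "\<forall>a\<in>{..<s ! 0}. finite (push_flow N s a ` left_flows k N (step_tuple s a))"
      using finite_left_flows assms by auto
    show "\<forall>a\<in>{..<s ! 0}. \<forall>b\<in>{..<s ! 0}. a \<noteq> b \<longrightarrow>
        push_flow N s a ` left_flows k N (step_tuple s a) \<inter>
        push_flow N s b ` left_flows k N (step_tuple s b) = {}"
    proof (intro ballI impI)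
      fix a b assume ab: "a \<in> {..<s ! 0}" "b \<in> {..<s ! 0}" "a \<noteq> b"
      \<comment> \<open>The flow on \<open>Slack N\<close> is \<open>s ! 0 - 1 - a\<close>, which
        determines \<open>a\<close> because \<open>a < s ! 0\<close>.\<close>
      have "push_flow N s a g (Slack N) \<noteq> push_flow N s b h (Slack N)" for g h
        using ab by (auto simp: push_flow_def)
      then show "push_flow N s a ` left_flows k N (step_tuple s a) \<inter>
        push_flow N s b ` left_flows k N (step_tuple s b) = {}"
        by (metis (no_types, lifting) disjoint_iff imageE)
    qed
  qed simp
  then show ?thesis by (simp add: card_image inj_on_push_flow)
qed

text \<open>The two occurrences of \<open>a\<close> cancel. The sum thus drops by one just as the
  cut does, so the left flows at the new cut are again counted by \<open>entringer\<close>.\<close>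

lemma sum_list_step_tuple:
  assumes "length s \<ge> 2" "a < s ! 0"
  shows "Suc (sum_list (step_tuple s a)) = sum_list s"
proof -
  obtain x y r where "s = x # y # r"
    using assms(1) by (metis Suc_le_length_iff numeral_2_eq_2)
  then show ?thesis using assms by (simp add: step_tuple_def)
qed

lemma entringer_step:
  assumes "length s \<ge> 2" "sum_list s \<ge> 1"
  shows "entringer s = (\<Sum>a<s ! 0. entringer (step_tuple s a))"
proof -
  obtain N where N: "sum_list s = Suc N"
    using assms(2) by (cases "sum_list s") auto
  have "entringer s = (\<Sum>a<s ! 0. card (left_flows (length s) N (step_tuple s a)))"
    using assms N by (simp add: entringer_eq_card_left_flows card_left_flows_Suc)
  also have "\<dots> = (\<Sum>a<s ! 0. entringer (step_tuple s a))"
  proof (rule sum.cong)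
    fix a assume "a \<in> {..<s ! 0}"
    then have "sum_list (step_tuple s a) = N"
      using sum_list_step_tuple[OF assms(1), of a] N by simp
    then show "card (left_flows (length s) N (step_tuple s a)) = entringer (step_tuple s a)"
      using entringer_eq_card_left_flows[of "step_tuple s a"] assms(1) by simp
  qed simp
  finally show ?thesis .
qed

lemma entringer_replicate_0:
  assumes "k \<ge> 2"
  shows "entringer (replicate k 0) = 1"
proof -
  have "\<forall>i\<in>{1..k-1}. replicate k (0::nat) ! i = 0" by auto
  moreover have "replicate k (0::nat) ! 0 = 0" using assms by simp
  ultimately show ?thesis
    using entringer_eq_card_left_flows[of "replicate k 0" k 0] assms
    by (simp add: left_flows_0)
qed

section \<open>The index sets of the sum and their recursion in \<open>j\<close>\<close>

lemma finite_weak_compositions: "finite (weak_compositions k n)"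
proof (rule finite_subset)
  show "weak_compositions k n \<subseteq> {xs. set xs \<subseteq> {..nat n} \<and> length xs = k}"
    using member_le_sum_list by (fastforce simp: weak_compositions_def)
  show "finite {xs. set xs \<subseteq> {..nat n} \<and> length xs = k}"
    by (rule finite_lists_length_eq) simp
qed

definition bounded_compositions :: "nat list \<Rightarrow> nat \<Rightarrow> nat list set" where
  "bounded_compositions s j =
     {u \<in> weak_compositions (j + 1) (int (sum_list s) - int j - int (sum_list (drop j s))).
        \<forall>h\<in>{1..j}. int (sum_list (take h u)) \<le> int (sum_list (take h s)) - int h}"

definition shifted_tuple :: "nat list \<Rightarrow> nat \<Rightarrow> nat list \<Rightarrow> nat list" where
  "shifted_tuple s j u = (u ! j + s ! j) # drop (j + 1) s @ take j u"

text \<open>The prescribed total is the sum of the first \<open>j\<close> entries of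
  \<open>s\<close>, less \<open>j\<close>. Moving all subtracted terms across removes the
  integers.\<close>

lemma bounded_compositions_iff:
  "u \<in> bounded_compositions s j \<longleftrightarrow>
     length u = j + 1 \<and> sum_list u + j = sum_list (take j s) \<and>
     (\<forall>h\<in>{1..j}. sum_list (take h u) + h \<le> sum_list (take h s))"
proof -
  have "sum_list s = sum_list (take j s) + sum_list (drop j s)"
    by (metis append_take_drop_id sum_list_append)
  then have "int (sum_list u) = int (sum_list s) - int j - int (sum_list (drop j s)) \<longleftrightarrow>
      sum_list u + j = sum_list (take j s)"
    by linarith
  moreover have "int a \<le> int b - int h \<longleftrightarrow> a + h \<le> b" for a b h by linarith
  ultimately show ?thesis
    by (simp add: bounded_compositions_def weak_compositions_def)
qed

text \<open>The bound with \<open>h = j\<close> says exactly that the entry \<open>p\<close> displaced by the next step is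
  nonnegative; the new bound with \<open>h = j + 1\<close> holds automatically.\<close>

lemma bounded_compositions_Suc_iff:
  assumes "j < length s" "length x = j"
  shows "x @ [a, b] \<in> bounded_compositions s (Suc j) \<longleftrightarrow>
    (\<exists>p. x @ [p] \<in> bounded_compositions s j \<and> a + b + 1 = p + s ! j)"
proof -
  have take_s: "sum_list (take (Suc j) s) = sum_list (take j s) + s ! j"
    using assms by (simp add: take_Suc_conv_app_nth)
  have range: "(\<forall>h\<in>{1..Suc j}. P h) \<longleftrightarrow> (\<forall>h\<in>{1..j}. P h) \<and> P (Suc j)" for P
    by (auto simp: atLeastAtMostSuc_conv)
  have takes: "(\<forall>h\<in>{1..j}. sum_list (take h (x @ r)) + h \<le> sum_list (take h s)) \<longleftrightarrow>
      (\<forall>h\<in>{1..j}. sum_list (take h x) + h \<le> sum_list (take h s))" for r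
    using assms by auto
  have bound: "sum_list x + j \<le> sum_list (take j s)"
    if "\<forall>h\<in>{1..j}. sum_list (take h x) + h \<le> sum_list (take h s)"
  proof (cases "j = 0")
    case True
    then show ?thesis using assms by simp
  next
    case False
    then show ?thesis using bspec[OF that, of j] assms by simp
  qed
  show ?thesis
  proof
    assume "x @ [a, b] \<in> bounded_compositions s (Suc j)"
    then have *: "sum_list x + a + b + Suc j = sum_list (take j s) + s ! j"
      "\<forall>h\<in>{1..j}. sum_list (take h x) + h \<le> sum_list (take h s)"
      unfolding bounded_compositions_iff range takes take_s by auto
    \<comment> \<open>The total required of \<open>x @ [p]\<close> leaves only this value;
      \<open>bound\<close> makes the subtraction exact.\<close>
    define p where "p = sum_list (take j s) - (sum_list x + j)"
    have "sum_list x + p + j = sum_list (take j s)" using bound[OF *(2)] by (simp add: p_def)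
    then show "\<exists>p. x @ [p] \<in> bounded_compositions s j \<and> a + b + 1 = p + s ! j"
      using * assms unfolding bounded_compositions_iff takes
      by (intro exI[of _ p]) auto
  next
    assume "\<exists>p. x @ [p] \<in> bounded_compositions s j \<and> a + b + 1 = p + s ! j"
    then show "x @ [a, b] \<in> bounded_compositions s (Suc j)"
      using assms unfolding bounded_compositions_iff range takes take_s by auto
  qed
qed

text \<open>A pair of \<open>u = x @ [p]\<close> and \<open>a < p + s ! j\<close> corresponds to
  \<open>x @ [a, b]\<close> with \<open>a + b + 1 = p + s ! j\<close>. The range of \<open>a\<close>
  is exactly what allows a natural number \<open>b\<close>.\<close>

lemma sum_bounded_compositions_Suc:
  assumes "j < length s"
  shows "(\<Sum>u\<in>bounded_compositions s j. \<Sum>a<u ! j + s ! j.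
            F (take j u @ [a, u ! j + s ! j - 1 - a]))
       = (\<Sum>u\<in>bounded_compositions s (Suc j). F u)"
proof -
  let ?S = "SIGMA u:bounded_compositions s j. {..<u ! j + s ! j}"
  let ?to = "\<lambda>(u, a). take j u @ [a, u ! j + s ! j - 1 - a]"
  \<comment> \<open>Solves \<open>a + b + 1 = p + s ! j\<close> for \<open>p\<close>, with
    \<open>a\<close> and \<open>b\<close> the last two entries of the longer composition.\<close>
  let ?from = "\<lambda>u. (take j u @ [u ! j + u ! Suc j + 1 - s ! j], u ! j)"
  have fin: "finite (bounded_compositions s j)"
    unfolding bounded_compositions_def using finite_weak_compositions by simp
  have snoc: "\<exists>x p. u = x @ [p] \<and> length x = j" if "u \<in> bounded_compositions s j" for u
    using that by (metis Suc_eq_plus1 bounded_compositions_iff length_Suc_conv_rev)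
  have snoc2: "\<exists>x a b. u = x @ [a, b] \<and> length x = j"
    if u: "u \<in> bounded_compositions s (Suc j)" for u
  proof -
    obtain x a y where "u = x @ y" "y = [a] @ [u ! Suc j]" "length x = j"
    proof
      have len: "length u = Suc (Suc j)" using u by (simp add: bounded_compositions_iff)
      show "u = take j u @ drop j u" by simp
      show "drop j u = [u ! j] @ [u ! Suc j]"
        using len by (simp add: Cons_nth_drop_Suc[symmetric])
      show "length (take j u) = j" using len by simp
    qed
    then show ?thesis by auto
  qed
  have "(\<Sum>u\<in>bounded_compositions s j. \<Sum>a<u ! j + s ! j.
            F (take j u @ [a, u ! j + s ! j - 1 - a])) = (\<Sum>(u, a)\<in>?S. F (?to (u, a)))"
    using fin by (simp add: sum.Sigma)
  also have "\<dots> = (\<Sum>u\<in>bounded_compositions s (Suc j). F u)"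
  proof (rule sum.reindex_bij_witness[where i = ?from and j = ?to])
    fix q assume q: "q \<in> ?S"
    then obtain u a where u: "q = (u, a)" "u \<in> bounded_compositions s j" "a < u ! j + s ! j" by auto
    then obtain x p where x: "u = x @ [p]" "length x = j" using snoc by blast
    show "?from (?to q) = q" using u x by (simp add: nth_append)
    show "?to q \<in> bounded_compositions s (Suc j)"
      using u x bounded_compositions_Suc_iff[OF assms x(2)]
      by (auto intro!: exI[of _ p])
    show "F (?to q) = (case q of (u, a) \<Rightarrow> F (?to (u, a)))" using u by simp
  next
    fix u assume u: "u \<in> bounded_compositions s (Suc j)"
    then obtain x a b where x: "u = x @ [a, b]" "length x = j" using snoc2 by blast
    then obtain p where p: "x @ [p] \<in> bounded_compositions s j" "a + b + 1 = p + s ! j"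
      using u bounded_compositions_Suc_iff[OF assms] by blast
    have from_u: "?from u = (x @ [p], a)" using x p(2) by (simp add: nth_append)
    have "p + s ! j - 1 - a = b" "a < p + s ! j" using p(2) by linarith+
    then show "?to (?from u) = u" "?from u \<in> ?S"
      unfolding from_u using x p(1) by (simp_all add: nth_append)
  qed
  finally show ?thesis .
qed

section \<open>Iterating the step \<open>j\<close> times\<close>

lemma length_shifted_tuple:
  assumes "u \<in> bounded_compositions s j" "j < length s"
  shows "length (shifted_tuple s j u) = length s"
  using assms by (simp add: shifted_tuple_def bounded_compositions_iff)

lemma sum_list_shifted_tuple:
  assumes "u \<in> bounded_compositions s j" "j < length s"
  shows "sum_list (shifted_tuple s j u) + j = sum_list s"
proof -
  have "s = take j s @ s ! j # drop (j + 1) s"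
    using assms by (simp add: id_take_nth_drop)
  then have "sum_list s = sum_list (take j s) + s ! j + sum_list (drop (j + 1) s)"
    by (metis add.assoc sum_list.Cons sum_list_append)
  moreover have "u = take j u @ [u ! j]"
    using assms(1) by (simp add: bounded_compositions_iff take_Suc_conv_app_nth[symmetric])
  then have "sum_list u = sum_list (take j u) + u ! j"
    by (metis add_0_right sum_list.Cons sum_list.Nil sum_list_append)
  ultimately show ?thesis using assms by (simp add: shifted_tuple_def bounded_compositions_iff)
qed

text \<open>Because \<open>Suc j < length s\<close>, the second entry of the shifted tuple is still
  \<open>s ! Suc j\<close> and not an entry of \<open>u\<close>. The step merges the remainder
  \<open>u ! j + s ! j - 1 - a\<close> with it and appends \<open>a\<close> after
  \<open>take j u\<close>.\<close>

lemma step_shifted_tuple: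
  assumes "u \<in> bounded_compositions s j" "Suc j < length s"
  shows "step_tuple (shifted_tuple s j u) a =
    shifted_tuple s (Suc j) (take j u @ [a, u ! j + s ! j - 1 - a])"
proof -
  have "drop (Suc j) s = s ! Suc j # drop (Suc (Suc j)) s"
    using assms by (simp add: Cons_nth_drop_Suc)
  then show ?thesis
    using assms by (simp add: step_tuple_def shifted_tuple_def bounded_compositions_iff nth_append)
qed

text \<open>The bound \<open>j \<le> sum_list s\<close> matters: for larger \<open>j\<close> the
  index set is empty, whereas for example \<open>entringer [1, 0, 0] = 1\<close>.\<close>

lemma entringer_iterated_step:
  assumes "length s \<ge> 2" "j < length s" "j \<le> sum_list s"
  shows "entringer s = (\<Sum>u\<in>bounded_compositions s j. entringer (shifted_tuple s j u))"
  using assms(2,3)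
proof (induction j)
  case 0
  have "bounded_compositions s 0 = {[0]}"
    by (auto simp: bounded_compositions_iff length_Suc_conv)
  moreover have "shifted_tuple s 0 [0] = s"
    using assms(1) by (cases s) (auto simp: shifted_tuple_def)
  ultimately show ?case by simp
next
  case (Suc j)
  have "entringer s = (\<Sum>u\<in>bounded_compositions s j. entringer (shifted_tuple s j u))"
    using Suc by simp
  also have "\<dots> = (\<Sum>u\<in>bounded_compositions s j. \<Sum>a<u ! j + s ! j.
      entringer (shifted_tuple s (Suc j) (take j u @ [a, u ! j + s ! j - 1 - a])))"
  proof (rule sum.cong)
    fix u assume u: "u \<in> bounded_compositions s j"
    \<comment> \<open>After \<open>j\<close> steps the sum is \<open>sum_list s - j\<close>, still
      positive since \<open>Suc j \<le> sum_list s\<close>, so another step applies.\<close>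
    have "length (shifted_tuple s j u) \<ge> 2" "sum_list (shifted_tuple s j u) \<ge> 1"
      using length_shifted_tuple[OF u] sum_list_shifted_tuple[OF u] Suc.prems assms(1) by auto
    moreover have "shifted_tuple s j u ! 0 = u ! j + s ! j" by (simp add: shifted_tuple_def)
    ultimately show "entringer (shifted_tuple s j u) = (\<Sum>a<u ! j + s ! j.
        entringer (shifted_tuple s (Suc j) (take j u @ [a, u ! j + s ! j - 1 - a])))"
      using step_shifted_tuple[OF u] Suc.prems by (simp add: entringer_step)
  qed simp
  also have "\<dots> = (\<Sum>u\<in>bounded_compositions s (Suc j). entringer (shifted_tuple s (Suc j) u))"
    using Suc.prems by (intro sum_bounded_compositions_Suc) simp
  finally show ?case .
qed

theorem theorem6p6:
  fixes k :: nat
  assumes "k \<ge> 2"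
  shows "(\<forall>N::nat. \<forall>s \<in> weak_compositions k (int N). \<forall>j \<in> {1..k-1}.
            N \<ge> 1 \<longrightarrow> j \<le> N \<longrightarrow>
            entringer s =
              (\<Sum>u \<in> {u \<in> weak_compositions (j + 1) (int N - int j - int (sum_list (drop j s))).
                        \<forall>h \<in> {1..j}. int (sum_list (take h u)) \<le> int (sum_list (take h s)) - int h}.
                 entringer ((u ! j + s ! j) # drop (j + 1) s @ take j u)))
         \<and> entringer (replicate k 0) = 1"
proof (intro conjI allI ballI impI)
  fix N s j
  assume s: "s \<in> weak_compositions k (int N)" and j: "j \<in> {1..k-1}" and N: "1 \<le> N" "j \<le> N"
  have "length s = k" "sum_list s = N" "j < k"
    using s j by (auto simp: weak_compositions_def)
  then show "entringer s =
      (\<Sum>u \<in> {u \<in> weak_compositions (j + 1) (int N - int j - int (sum_list (drop j s))).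
                \<forall>h \<in> {1..j}. int (sum_list (take h u)) \<le> int (sum_list (take h s)) - int h}.
         entringer ((u ! j + s ! j) # drop (j + 1) s @ take j u))"
    using entringer_iterated_step[of s j] assms j N
    by (simp add: bounded_compositions_def shifted_tuple_def)
next
  show "entringer (replicate k 0) = 1" using assms by (rule entringer_replicate_0)
qed

end
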